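(* Let $A$ be a commutative ring and let $I,J$ be ideals of $A$. Then $IJ\subseteq I\cap J\subseteq I+J\subseteq [I:J]$.
   Context: All rings are commutative with identity. For ideals $I,J$ of a ring $A$, $\operatorname{Ann}(I)=\{a\in A\mid aI=0\}$ and $(J:I)=\{a\in A\mid aI\subseteq J\}$. The coproduct of $I$ and $J$ is the ideal $[I:J]:=(J:\operatorname{Ann}(I))=\{a\in A\mid a\operatorname{Ann}(I)\subseteq J\}$. *)

theory Defs
  imports "HOL-Algebra.Ideal_Product"
begin

definition ideal_ann :: "('a, 'b) ring_scheme \<Rightarrow> 'a set \<Rightarrow> 'a set"
  where "ideal_ann A I = {a \<in> carrier A. \<forall>x \<in> I. a \<otimes>\<^bsub>A\<^esub> x = \<zero>\<^bsub>A\<^esub>}"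

(* Argument order follows the notation (J : I). *)
definition ideal_colon :: "('a, 'b) ring_scheme \<Rightarrow> 'a set \<Rightarrow> 'a set \<Rightarrow> 'a set"
  where "ideal_colon A J I = {a \<in> carrier A. \<forall>x \<in> I. a \<otimes>\<^bsub>A\<^esub> x \<in> J}"

(* The coproduct [I : J]; its arguments are in the opposite order to those of the colon. *)
definition ideal_coprod :: "('a, 'b) ring_scheme \<Rightarrow> 'a set \<Rightarrow> 'a set \<Rightarrow> 'a set"
  where "ideal_coprod A I J = ideal_colon A J (ideal_ann A I)"

lemma (in cring) ideal_colon_is_ideal:
  assumes J: "ideal J R" and I: "I \<subseteq> carrier R"
  shows "ideal (ideal_colon R J I) R"
proof -
  interpret J: ideal J R by (rule J)
  have neg: "(\<ominus> a) \<otimes> x \<in> J" if "a \<in> carrier R" "x \<in> I" "a \<otimes> x \<in> J" for a x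
    using that I by (auto simp: l_minus subset_iff intro: J.a_inv_closed)
  have mult: "(b \<otimes> a) \<otimes> x \<in> J" if "a \<in> carrier R" "b \<in> carrier R" "x \<in> I" "a \<otimes> x \<in> J" for a b x
    using that I by (auto simp: m_assoc subset_iff intro: J.I_l_closed)
  show ?thesis
  proof (rule idealI)
    show "subgroup (ideal_colon R J I) (add_monoid R)"
    proof (rule add.subgroupI)
      show "ideal_colon R J I \<noteq> {}"
        using I by (auto simp: ideal_colon_def subset_iff intro!: exI[of _ \<zero>])
      show "\<And>a. a \<in> ideal_colon R J I \<Longrightarrow> \<ominus> a \<in> ideal_colon R J I"
        using neg by (auto simp: ideal_colon_def)
      show "\<And>a b. a \<in> ideal_colon R J I \<Longrightarrow> b \<in> ideal_colon R J I
              \<Longrightarrow> a \<oplus> b \<in> ideal_colon R J I"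
        using I by (auto simp: ideal_colon_def l_distr subset_iff intro!: J.a_closed)
    qed (auto simp: ideal_colon_def)
    show "\<And>a x. a \<in> ideal_colon R J I \<Longrightarrow> x \<in> carrier R \<Longrightarrow> x \<otimes> a \<in> ideal_colon R J I"
      using mult by (auto simp: ideal_colon_def)
    then show "\<And>a x. a \<in> ideal_colon R J I \<Longrightarrow> x \<in> carrier R \<Longrightarrow> a \<otimes> x \<in> ideal_colon R J I"
      by (simp add: ideal_colon_def m_comm)
  qed (rule ring_axioms)
qed

lemma (in cring) ideal_coprod_is_ideal:
  assumes "ideal J R"
  shows "ideal (ideal_coprod R I J) R"
  unfolding ideal_coprod_def
  by (rule ideal_colon_is_ideal[OF assms]) (auto simp: ideal_ann_def)

end

theory Submission
  imports Defs
begin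

text \<open>Only the last inclusion involves annihilators. If \<open>x\<close> kills
  \<open>I\<close>, then multiplying \<open>i \<oplus> j\<close> by \<open>x\<close> makes the
  \<open>I\<close>-part vanish and leaves \<open>j \<otimes> x\<close>, which \<open>J\<close>
  absorbs; this is \<open>ideal_sum_subset_coprod\<close>. The other two inclusions are general
  ideal arithmetic.\<close>

lemma (in cring) ideal_sum_subset_coprod:
  assumes "ideal I R" and "ideal J R"
  shows "I <+>\<^bsub>R\<^esub> J \<subseteq> ideal_coprod R I J"
proof
  interpret I: ideal I R by fact
  interpret J: ideal J R by fact
  fix a assume "a \<in> I <+>\<^bsub>R\<^esub> J"
  then obtain i j where a: "a = i \<oplus> j" and i: "i \<in> I" and j: "j \<in> J"
    by (auto simp: set_add_def')
  have carr: "i \<in> carrier R" "j \<in> carrier R"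
    using i j by (simp_all add: I.Icarr J.Icarr)
  have "a \<otimes> x \<in> J" if x: "x \<in> ideal_ann R I" for x
  proof -
    have xc: "x \<in> carrier R" and "x \<otimes> i = \<zero>"
      using x i by (auto simp: ideal_ann_def)
    \<comment> \<open>Commutativity is used here: \<open>ideal_ann\<close> puts the annihilator on
      the left, giving \<open>x \<otimes> i = \<zero>\<close>, while distributing yields
      \<open>i \<otimes> x\<close>.\<close>
    then have "a \<otimes> x = j \<otimes> x"
      using carr by (simp add: a l_distr m_comm[of i x])
    then show ?thesis
      using j xc by (simp add: J.I_r_closed)
  qed
  then show "a \<in> ideal_coprod R I J"
    using carr by (auto simp: ideal_coprod_def ideal_colon_def a)
qed

theorem corollary1:
  fixes A :: "('a, 'b) ring_scheme" and I J :: "'a set"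
  assumes "cring A" and "ideal I A" and "ideal J A"
  shows "I \<cdot>\<^bsub>A\<^esub> J \<subseteq> I \<inter> J \<and> I \<inter> J \<subseteq> I <+>\<^bsub>A\<^esub> J \<and> I <+>\<^bsub>A\<^esub> J \<subseteq> ideal_coprod A I J"
proof (intro conjI)
  interpret cring A by fact
  interpret I: ideal I A by fact
  interpret J: ideal J A by fact
  show "I \<cdot>\<^bsub>A\<^esub> J \<subseteq> I \<inter> J"
    \<comment> \<open>Absorption: each generator of the product is a multiple of an element of
      \<open>I\<close> and of one of \<open>J\<close>, and both ideals are closed under
      sums.\<close>
    using assms(2,3) by (rule ideal_prod_inter)
  show "I \<inter> J \<subseteq> I <+>\<^bsub>A\<^esub> J"
  proof
    fix x assume "x \<in> I \<inter> J"
    \<comment> \<open>The sum is witnessed by \<open>x\<close> from \<open>I\<close> and zero from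
      \<open>J\<close>.\<close>
    then have "x \<in> I" and "x = x \<oplus>\<^bsub>A\<^esub> \<zero>\<^bsub>A\<^esub>"
      by (auto simp: I.Icarr)
    moreover have "\<zero>\<^bsub>A\<^esub> \<in> J"
      by simp
    ultimately show "x \<in> I <+>\<^bsub>A\<^esub> J"
      unfolding set_add_def' by blast
  qed
  show "I <+>\<^bsub>A\<^esub> J \<subseteq> ideal_coprod A I J"
    using assms(2,3) by (rule ideal_sum_subset_coprod)
qed

end
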